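(* Let $f_1=(a_1,b_1,c_1,d_1)$ and $f_2=(a_2,b_2,c_2,d_2)$ be two quadruples of complex numbers with $a_1d_1-b_1c_1\neq 0$ and $a_2d_2-b_2c_2\neq 0$, regarded as coefficient quadruples of linear fractional transformations of $\mathbb{C}_\infty=\mathbb{C}\cup\{\infty\}$. Then $f_1(z)=f_2(z)$ for all $z\in\mathbb{C}_\infty$ if and only if there exists $k\in\mathbb{C}$ with $k\neq 0$ such that $a_2=ka_1$, $b_2=kb_1$, $c_2=kc_1$ and $d_2=kd_1$.
   Context: The extended complex plane is $\mathbb{C}_\infty=\mathbb{C}\cup\{\infty\}$, the disjoint union of $\mathbb{C}$ and one extra point $\infty$. A quadruple $f=(a,b,c,d)\in\mathbb{C}^4$ with $ad-bc\neq 0$ acts on $\mathbb{C}_\infty$ as follows. If $c=0$: $f(z)=(a/d)z+(b/d)$ for $z\in\mathbb{C}$ and $f(\infty)=\infty$. If $c\neq 0$: $f(z)=\frac{az+b}{cz+d}$ for $z\in\mathbb{C}$, $z\neq -d/c$; $f(-d/c)=\infty$; and $f(\infty)=a/c$. *)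

theory Defs
  imports Complex_Main
begin

datatype ext_complex = Fin complex | Infty

type_synonym quadruple = "complex \<times> complex \<times> complex \<times> complex"

fun nondegenerate :: "quadruple \<Rightarrow> bool" where
  "nondegenerate (a, b, c, d) \<longleftrightarrow> a * d - b * c \<noteq> 0"

text \<open>The action is only meaningful for nondegenerate quadruples; otherwise, division
  by zero is evaluated with the convention \<open>x / 0 = 0\<close>.\<close>

fun lft :: "quadruple \<Rightarrow> ext_complex \<Rightarrow> ext_complex" where
  "lft (a, b, c, d) (Fin z) =
     (if c = 0 then Fin ((a / d) * z + b / d)
      else if z = - d / c then Infty
      else Fin ((a * z + b) / (c * z + d)))"
| "lft (a, b, c, d) Infty = (if c = 0 then Infty else Fin (a / c))"

end

theory Submission
  imports Defs
begin

text \<open>Scaling all four coefficients by a nonzero \<open>k\<close> cancels in every quotient.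
  Conversely, a few values determine the quadruple up to scale: whether \<open>Infty\<close> is
  fixed tells if \<open>c = 0\<close>. If so, the values at 0 and 1 give \<open>b / d\<close> and
  \<open>a / d\<close>; if not, the value at \<open>Infty\<close>, the pole and one more point give
  \<open>a / c\<close>, \<open>d / c\<close> and \<open>b / c\<close>.\<close>

theorem mainTheorem1:
  fixes a1 b1 c1 d1 a2 b2 c2 d2 :: complex
  assumes "nondegenerate (a1, b1, c1, d1)"
    and "nondegenerate (a2, b2, c2, d2)"
  shows "(\<forall>z :: ext_complex. lft (a1, b1, c1, d1) z = lft (a2, b2, c2, d2) z) \<longleftrightarrow>
    (\<exists>k :: complex. k \<noteq> 0 \<and> a2 = k * a1 \<and> b2 = k * b1 \<and> c2 = k * c1 \<and> d2 = k * d1)"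
  (is "?L \<longleftrightarrow> ?R")
proof
  assume L: ?L
  have eq: "lft (a1, b1, c1, d1) z = lft (a2, b2, c2, d2) z" for z
    using L by blast
  show ?R
  proof (cases "c1 = 0")
    case True
    have c2: "c2 = 0"
      using eq[of Infty] True by (auto split: if_splits)
    have d: "d1 \<noteq> 0" "d2 \<noteq> 0"
      using assms True c2 by auto
    have b: "b1 / d1 = b2 / d2"
      using eq[of "Fin 0"] True c2 by simp
    have a: "a1 / d1 = a2 / d2"
      using eq[of "Fin 1"] True c2 b by simp
    show ?thesis
      using True c2 d a b by (intro exI[of _ "d2 / d1"]) (simp add: field_simps)
  next
    case False
    have c2: "c2 \<noteq> 0"
      using eq[of Infty] False by (auto split: if_splits)
    have a: "a1 / c1 = a2 / c2"
      using eq[of Infty] False c2 by simp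
    have d: "d1 / c1 = d2 / c2"
      \<comment> \<open>The pole of the first map must also be the pole of the second.\<close>
      using eq[of "Fin (- d1 / c1)"] False c2 by (auto split: if_splits)
    \<comment> \<open>At this point both denominators reduce to their leading coefficients.\<close>
    define z where "z = 1 - d1 / c1"
    have z1: "c1 * z + d1 = c1"
      using False by (simp add: z_def field_simps)
    have z2: "c2 * z + d2 = c2"
      using c2 by (simp add: z_def d field_simps)
    \<comment> \<open>\<open>z\<close> is the common pole shifted by 1, so both maps are finite
      there.\<close>
    have "z \<noteq> - d1 / c1" "z \<noteq> - d2 / c2"
      by (simp_all add: z_def d)
    then have "(a1 * z + b1) / c1 = (a2 * z + b2) / c2"
      using eq[of "Fin z"] False c2 z1 z2 by simp
    then have "a1 / c1 * z + b1 / c1 = a2 / c2 * z + b2 / c2"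
      by (simp add: add_divide_distrib)
    then have b: "b1 / c1 = b2 / c2"
      using a by simp
    show ?thesis
      using False c2 a b d by (intro exI[of _ "c2 / c1"]) (simp add: field_simps)
  qed
next
  assume ?R
  then obtain k where k: "k \<noteq> 0" "a2 = k * a1" "b2 = k * b1" "c2 = k * c1" "d2 = k * d1"
    by blast
  have "lft (a1, b1, c1, d1) (Fin z) = lft (a2, b2, c2, d2) (Fin z)" for z
  proof -
    have "(k * a1 * z + k * b1) / (k * c1 * z + k * d1) = (k * (a1 * z + b1)) / (k * (c1 * z + d1))"
      by (simp add: algebra_simps)
    \<comment> \<open>Holds even where \<open>c1 * z + d1 = 0\<close>: both sides are then 0 since
      \<open>x / 0 = 0\<close>.\<close>
    also have "\<dots> = (a1 * z + b1) / (c1 * z + d1)"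
      using k(1) by (rule mult_divide_mult_cancel_left)
    finally have "(k * a1 * z + k * b1) / (k * c1 * z + k * d1) = (a1 * z + b1) / (c1 * z + d1)" .
    \<comment> \<open>Makes the pole tests in \<open>lft\<close> agree.\<close>
    moreover have "- (k * d1) / (k * c1) = - d1 / c1"
      using k(1) by simp
    ultimately show ?thesis
      using k by simp
  qed
  moreover have "lft (a1, b1, c1, d1) Infty = lft (a2, b2, c2, d2) Infty"
    using k by simp
  ultimately show ?L
    by (metis ext_complex.exhaust)
qed

end
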